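(* $$\sum_{k=0}^{\infty}(42k+5)\frac{\left(\frac{1}{2}\right)_k^3}{k!^3\,64^k}\left\{H_{2k}^{(2)}-\frac{25}{92}H_{k}^{(2)}\right\}=\frac{2\pi}{69}.$$
   Context: For a complex number $x$ and a nonnegative integer $n$, the shifted factorial is $(x)_n=\Gamma(x+n)/\Gamma(x)$, i.e. $(x)_0=1$ and $(x)_n=x(x+1)\cdots(x+n-1)$ for $n\ge 1$; $(x)_k^3$ means $((x)_k)^3$ and $k!^3$ means $(k!)^3$. The harmonic number of order two is $H_n^{(2)}=\sum_{j=1}^{n}\frac{1}{j^2}$, with $H_0^{(2)}=0$. *)

theory Defs
  imports "HOL-Analysis.Analysis"
begin

definition harm2 :: "nat \<Rightarrow> real" where
  "harm2 n = (\<Sum>j=1..n. 1 / (real j)^2)"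

end

(* The telescoping pair behind Ramanujan's series for 16/pi with linear factor 42k+5 extends to a
   family in two parameters x, z: with F = 2n B and
     B(n,k) = (1/2+x)_{n+k} (1/2-x)_{n+k} (1/2+z-x)_n (1/2-z+x)_n (1/2+z+x)_n (1/2-z-x)_n
              / ((1+z)_{2n+k} (1-z)_{2n+k} (2n)!),
   one has F(n+1,k) - F(n,k) = G(n,k+1) - G(n,k) for a suitable rational multiple G of B. Everything
   is even in x and z, and to first order in u = z^2 the logarithmic derivative of B(n,0) is
   proportional to the combination of harmonic numbers in the theorem exactly if x^2 = 3/8 z^2.
   The proof differentiates the pair at u = 0. Since F vanishes at n = 0 and as n tends to infinity,
   the sum of G(n,k) over n does not depend on k; as k tends to infinity only its term n = 0
   survives, and this term is evaluated by Wallis' product and Euler's zeta(2) = pi^2/6. *)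

theory Submission
  imports Defs "HOL-Real_Asymp.Real_Asymp"
begin

section \<open>The telescoping pair at u = 0: \<open>wz_base\<close> is \<open>B\<close> at x = z =
  0, followed by the first-order data in u\<close>

definition wz_base :: "nat \<Rightarrow> nat \<Rightarrow> real" where
  "wz_base n k = pochhammer (1/2) (n + k) ^ 2 * pochhammer (1/2) n ^ 4
     / (fact (2 * n + k) ^ 2 * fact (2 * n))"

text \<open>This is the sum of \<open>1 / (j + 1/2)^2\<close> over \<open>j < n\<close>.\<close>

definition odd_harm2 :: "nat \<Rightarrow> real" where
  "odd_harm2 n = 4 * harm2 (2 * n) - harm2 n"

text \<open>The derivative of \<open>ln B(n,k)\<close> with respect to \<open>u\<close> at \<open>u = 0\<close>.\<close>

definition wz_log :: "nat \<Rightarrow> nat \<Rightarrow> real" where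
  "wz_log n k = harm2 (2 * n + k) - 3/8 * odd_harm2 (n + k) - 11/4 * odd_harm2 n"

text \<open>In the parametric family \<open>G / B\<close> equals \<open>Q / ((2n+1) ((2n+k+1)^2 - u))\<close> for a polynomial
  \<open>Q\<close> in \<open>n\<close>, \<open>k\<close>, \<open>u\<close>. Here \<open>(2n+1) cert0 n k\<close> and \<open>cert1 n k\<close> are the coefficients of
  \<open>u^0\<close> and \<open>u^1\<close> in \<open>Q\<close>, and \<open>wz_mult\<close>, \<open>wz_mult'\<close> are those of \<open>G / B\<close>.\<close>

definition cert0 :: "real \<Rightarrow> real \<Rightarrow> real" where
  "cert0 x y = y^3 + (13/2 * x + 9/4) * y^2 + (14 * x^2 + 10 * x + 3/2) * y
     + (2 * x + 1)^2 * (42 * x + 5) / 16"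

definition cert1 :: "real \<Rightarrow> real \<Rightarrow> real" where
  "cert1 x y = 5/8 * y^2 + (x/2 + 1/4) * y - (2 * x + 1) * (42 * x + 5) / 16"

definition wz_mult :: "nat \<Rightarrow> nat \<Rightarrow> real" where
  "wz_mult n k = cert0 n k / (2 * real n + real k + 1)^2"

definition wz_mult' :: "nat \<Rightarrow> nat \<Rightarrow> real" where
  "wz_mult' n k = cert1 n k / ((2 * real n + 1) * (2 * real n + real k + 1)^2)
     + cert0 n k / (2 * real n + real k + 1)^4"

definition wz_F :: "nat \<Rightarrow> nat \<Rightarrow> real" where
  "wz_F n k = 2 * real n * wz_base n k * wz_log n k"

text \<open>The product rule for the u-derivative of G = B * (G / B) at u = 0, just as
  \<open>wz_F\<close> is that of F = 2n B.\<close>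

definition wz_G :: "nat \<Rightarrow> nat \<Rightarrow> real" where
  "wz_G n k = wz_base n k * (wz_mult n k * wz_log n k + wz_mult' n k)"

section \<open>Harmonic sums of order two: recurrences, bounds and limits\<close>

lemma harm2_Suc: "harm2 (Suc n) = harm2 n + 1 / (real n + 1)^2"
  by (simp add: harm2_def add.commute)

lemma harm2_nonneg: "harm2 n \<ge> 0"
  unfolding harm2_def by (intro sum_nonneg) auto

lemma harm2_tendsto: "harm2 \<longlonglongrightarrow> pi^2 / 6"
proof -
  have "harm2 = (\<lambda>n. \<Sum>i<n. 1 / (real (Suc i))^2)"
  proof
    show "harm2 n = (\<Sum>i<n. 1 / (real (Suc i))^2)" for n
      by (induction n) (auto simp: harm2_Suc harm2_def[of 0] add.commute)
  qed
  then show ?thesis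
    using inverse_squares_sums by (simp add: sums_def add.commute)
qed

lemma harm2_le: "harm2 n \<le> 2"
proof -
  have "incseq harm2"
    by (intro incseq_SucI) (simp add: harm2_Suc)
  then have "harm2 n \<le> pi^2 / 6"
    using harm2_tendsto by (rule incseq_le)
  also have "pi^2 \<le> (3.2::real)^2"
    using pi_approx by (intro power_mono) auto
  finally show ?thesis by (simp add: power2_eq_square)
qed

lemma odd_harm2_Suc: "odd_harm2 (Suc n) = odd_harm2 n + 1 / (real n + 1/2)^2"
proof -
  have "harm2 (2 * Suc n) = harm2 (2 * n) + 1 / (2 * real n + 1)^2 + 1 / (2 * real n + 2)^2"
    by (simp add: harm2_Suc add.commute)
  moreover have "4 / (2 * real n + 1)^2 = 1 / (real n + 1/2)^2"
    by (simp add: field_simps power2_eq_square)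
  moreover have "4 / (2 * real n + 2)^2 = 1 / (real n + 1)^2"
    by (simp add: divide_simps) (simp add: power2_eq_square algebra_simps)
  ultimately show ?thesis
    by (simp add: odd_harm2_def harm2_Suc algebra_simps)
qed

lemma odd_harm2_bounds: "0 \<le> odd_harm2 n" "odd_harm2 n \<le> 8"
proof -
  show "0 \<le> odd_harm2 n"
    by (induction n) (auto simp: odd_harm2_Suc, simp add: odd_harm2_def harm2_def)
  show "odd_harm2 n \<le> 8"
    unfolding odd_harm2_def using harm2_le[of "2 * n"] harm2_nonneg[of n] by linarith
qed

lemma odd_harm2_tendsto: "odd_harm2 \<longlonglongrightarrow> pi^2 / 2"
proof -
  have "(\<lambda>n. harm2 (2 * n)) \<longlonglongrightarrow> pi^2 / 6"
    using LIMSEQ_subseq_LIMSEQ[OF harm2_tendsto, of "\<lambda>n. 2 * n"]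
    by (simp add: strict_mono_def o_def)
  from tendsto_diff[OF tendsto_mult[OF tendsto_const[of 4] this] harm2_tendsto]
  show ?thesis by (simp add: odd_harm2_def[abs_def] field_simps)
qed

text \<open>The triangle inequality gives 2 + 3/8 * 8 + 11/4 * 8 = 27; what matters is that the
  bound is uniform in \<open>n\<close> and \<open>k\<close>.\<close>

lemma wz_log_bound: "\<bar>wz_log n k\<bar> \<le> 27"
  unfolding wz_log_def
  using harm2_le[of "2 * n + k"] harm2_nonneg[of "2 * n + k"]
    odd_harm2_bounds[of "n + k"] odd_harm2_bounds[of n]
  by linarith

lemma wz_log_Suc_left:
  "wz_log (Suc n) k = wz_log n k + 1 / (2 * real n + real k + 1)^2 + 1 / (2 * real n + real k + 2)^2
     - 3/8 / (real n + real k + 1/2)^2 - 11/4 / (real n + 1/2)^2"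
  by (simp add: wz_log_def odd_harm2_Suc harm2_Suc add_ac add_divide_distrib)

lemma wz_log_Suc_right:
  "wz_log n (Suc k) = wz_log n k + 1 / (2 * real n + real k + 1)^2 - 3/8 / (real n + real k + 1/2)^2"
  by (simp add: wz_log_def odd_harm2_Suc harm2_Suc add_ac add_divide_distrib)

section \<open>Recurrences of B and the telescoping identity\<close>

lemma wz_base_nonneg: "wz_base n k \<ge> 0"
  unfolding wz_base_def by (intro divide_nonneg_nonneg mult_nonneg_nonneg) auto

text \<open>The factor \<open>2 * real (Suc n)\<close> is the one in \<open>wz_F\<close>. It cancels
  2n+2 in (2n+2)!, while 2n+1 = 2(n+1/2) lowers the fourth power of n+1/2 to a cube.\<close>

lemma wz_base_Suc_left:
  "2 * real (Suc n) * wz_base (Suc n) k =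
     wz_base n k * ((real n + real k + 1/2)^2 * (real n + 1/2)^3
       / (2 * (2 * real n + real k + 1)^2 * (2 * real n + real k + 2)^2))"
proof -
  define p q f g where "p = pochhammer (1/2::real) (n + k)" and "q = pochhammer (1/2::real) n"
    and "f = (fact (2 * n + k) :: real)" and "g = (fact (2 * n) :: real)"
  have e: "pochhammer (1/2::real) (Suc n + k) = p * (real n + real k + 1/2)"
    "pochhammer (1/2::real) (Suc n) = q * (real n + 1/2)"
    "(fact (2 * Suc n + k) :: real) = (2 * real n + real k + 2) * ((2 * real n + real k + 1) * f)"
    "(fact (2 * Suc n) :: real) = (2 * real n + 2) * (2 * (real n + 1/2) * g)"
    by (simp_all add: p_def q_def f_def g_def pochhammer_Suc add_ac algebra_simps)
  define a h m s where "a = real n + real k + 1/2" and "h = real n + 1/2"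
    and "m = 2 * real n + real k + 1" and "s = 2 * real n + 2"
  have pos: "h > 0" "m > 0" "m + 1 > 0" "s > 0" by (auto simp: h_def m_def s_def)
  have "s * ((p * a)^2 * (q * h)^4
      / (((m + 1) * (m * f))^2 * (s * (2 * h * g))))
    = s * h * (p^2 * q^4 * (a^2 * h^3))
      / (s * h * (f^2 * g * (2 * m^2 * (m + 1)^2)))"
    by (simp add: power_mult_distrib power4_eq_xxxx power3_eq_cube mult_ac)
  also have "\<dots> = p^2 * q^4 / (f^2 * g) * (a^2 * h^3 / (2 * m^2 * (m + 1)^2))"
    using pos by (subst mult_divide_mult_cancel_left) auto
  finally have "s * ((p * a)^2 * (q * h)^4
      / (((m + 1) * (m * f))^2 * (s * (2 * h * g))))
    = p^2 * q^4 / (f^2 * g) * (a^2 * h^3 / (2 * m^2 * (m + 1)^2))" .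
  then show ?thesis
    unfolding wz_base_def e unfolding p_def[symmetric] q_def[symmetric] f_def[symmetric] g_def[symmetric]
    by (simp add: a_def h_def m_def s_def add_ac)
qed

lemma wz_base_Suc_right:
  "wz_base n (Suc k) =
     wz_base n k * ((real n + real k + 1/2)^2 / (2 * real n + real k + 1)^2)"
proof -
  have "pochhammer (1/2::real) (n + Suc k) = pochhammer (1/2) (n + k) * (real n + real k + 1/2)"
    "(fact (2 * n + Suc k) :: real) = (2 * real n + real k + 1) * fact (2 * n + k)"
    by (simp_all add: pochhammer_Suc add_ac algebra_simps)
  then show ?thesis
    unfolding wz_base_def by (simp add: power_mult_distrib mult_ac)
qed

text \<open>With \<open>x\<close>, \<open>y\<close> for n, k and m = 2n+k+1: divide the pair
  equation of the family by B(n,k) and multiply by (m^2 - u)((m+1)^2 - u). This is the coefficient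
  of u^0; \<open>cert1_rec\<close> is that of u^1, multiplied by 2n+1.\<close>

lemma cert0_rec:
  fixes x y :: real
  shows "(x + y + 1/2)^2 * (x + 1/2)^3 / 2 - 2 * x * (2 * x + y + 1)^2 * (2 * x + y + 2)^2
    = (x + y + 1/2)^2 * cert0 x (y + 1) - (2 * x + y + 2)^2 * cert0 x y"
  unfolding cert0_def by (simp add: field_simps eval_nat_numeral)

lemma cert1_rec:
  fixes x y :: real
  shows "(2 * x + 1) * (2 * x * ((2 * x + y + 1)^2 + (2 * x + y + 2)^2) - cert0 x y
      - 3/16 * (x + 1/2)^3 - 11/8 * (x + y + 1/2)^2 * (x + 1/2) + 3/8 * cert0 x (y + 1))
    = (x + y + 1/2)^2 * cert1 x (y + 1) - (2 * x + y + 2)^2 * cert1 x y"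
  unfolding cert0_def cert1_def by (simp add: field_simps eval_nat_numeral)

text \<open>After division by \<open>wz_base n k\<close> both sides are affine in
  \<open>wz_log n k\<close>: \<open>z0\<close> matches the coefficients of
  \<open>wz_log n k\<close>, \<open>z1\<close> the remaining terms.\<close>

lemma wz_pair: "wz_F (Suc n) k - wz_F n k = wz_G n (Suc k) - wz_G n k"
proof -
  define x y where "x = real n" and "y = real k"
  define a h m where "a = x + y + 1/2" and "h = x + 1/2" and "m = 2 * x + y + 1"
  define P P' Q Q' where "P = cert0 x y" and "P' = cert0 x (y + 1)"
    and "Q = cert1 x y" and "Q' = cert1 x (y + 1)"
  define b l where "b = wz_base n k" and "l = wz_log n k"
  have pos: "a > 0" "h > 0" "m > 0" "m + 1 > 0"
    by (auto simp: a_def h_def m_def x_def y_def)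
  have r0: "a^2 * h^3 / 2 - 2 * x * m^2 * (m + 1)^2 = a^2 * P' - (m + 1)^2 * P"
    using cert0_rec[of x y] by (simp add: a_def h_def m_def P_def P'_def add_ac)
  have r1: "2 * h * (2 * x * (m^2 + (m + 1)^2) - P - 3/16 * h^3 - 11/8 * a^2 * h + 3/8 * P')
      = a^2 * Q' - (m + 1)^2 * Q"
    using cert1_rec[of x y] by (simp add: a_def h_def m_def P_def P'_def Q_def Q'_def add_ac)
  define M N where "M = m^2" and "N = (m + 1)^2"
  define R where "R = a^2 * h^3 / (2 * M * N)"
  define d e where "d = 1 / M + 1 / N - 3/8 / a^2 - 11/4 / h^2" and "e = 1 / M - 3/8 / a^2"
  define T T' where "T = Q / (2 * h * M) + P / M^2" and "T' = Q' / (2 * h * N) + P' / N^2"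
  have MN: "M > 0" "N > 0" using pos by (auto simp: M_def N_def)
  have z0: "R - 2 * x = a^2 / M * (P' / N) - P / M"
  proof -
    have "R - 2 * x = (a^2 * h^3 / 2 - 2 * x * M * N) / (M * N)"
      using MN unfolding R_def by (simp add: field_simps)
    also have "\<dots> = (a^2 * P' - N * P) / (M * N)"
      using r0 by (simp add: M_def N_def)
    also have "\<dots> = a^2 / M * (P' / N) - P / M"
      using MN by (simp add: field_simps)
    finally show ?thesis .
  qed
  have z1: "R * d = a^2 / M * (P' / N * e + T') - T"
  proof -
    define c U where "c = 1 / M + 1 / N" and "U = a^2 * h^3 / 2"
    have U: "U * (3/8 / a^2) = 3/16 * h^3" "U * (11/4 / h^2) = 11/8 * a^2 * h"
      using pos by (simp_all add: U_def field_simps eval_nat_numeral)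
    \<comment> \<open>Replacing \<open>U\<close> by means of \<open>r0\<close> produces the
      polynomial part needed for \<open>r1\<close>; the fractions left over are those on the
      right-hand side of \<open>z1\<close>.\<close>
    have Uc: "U * c = 2 * x * (M + N) - P - N * P / M + a^2 * P' * c"
    proof -
      have "U = 2 * x * M * N + (a^2 * P' - N * P)"
        using r0 by (simp add: U_def M_def N_def)
      moreover have "(2 * x * M * N + (a^2 * P' - N * P)) * c
          = 2 * x * (M + N) - P - N * P / M + a^2 * P' * c"
        using MN by (simp add: c_def field_simps)
      ultimately show ?thesis by simp
    qed
    have Q: "a^2 * Q' / (2 * h) - N * Q / (2 * h)
        = 2 * x * (M + N) - P - 3/16 * h^3 - 11/8 * a^2 * h + 3/8 * P'"
    proof -
      have "a^2 * Q' / (2 * h) - N * Q / (2 * h) = (a^2 * Q' - N * Q) / (2 * h)"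
        by (rule diff_divide_distrib[symmetric])
      also have "\<dots> = 2 * x * (M + N) - P - 3/16 * h^3 - 11/8 * a^2 * h + 3/8 * P'"
        unfolding M_def N_def r1[symmetric] using pos by simp
      finally show ?thesis .
    qed
    have e: "a^2 * e = a^2 / M - 3/8" "N * T' = Q' / (2 * h) + P' / N"
        "M * T = Q / (2 * h) + P / M"
      using MN pos by (simp_all add: e_def T_def T'_def right_diff_distrib distrib_left power2_eq_square)
    have "M * N * (R * d) = U * d"
      using MN by (simp add: R_def U_def)
    also have "\<dots> = U * c - U * (3/8 / a^2) - U * (11/4 / h^2)"
      unfolding d_def c_def by (simp only: right_diff_distrib)
    also have "\<dots> = a^2 * P' * c - 3/8 * P' - N * P / M + (a^2 * Q' / (2 * h) - N * Q / (2 * h))"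
      unfolding U Uc Q by simp
    also have "\<dots> = P' * (a^2 * e) + a^2 * (N * T') - N * (M * T)"
      unfolding e c_def by (simp add: algebra_simps)
    also have "\<dots> = M * N * (a^2 / M * (P' / N * e + T') - T)"
      using MN by (simp add: right_diff_distrib distrib_left)
    finally show ?thesis using MN by simp
  qed
  have FS: "wz_F (Suc n) k = b * R * (l + d)"
  proof -
    have "2 * real (Suc n) * wz_base (Suc n) k = b * R"
      unfolding wz_base_Suc_left by (simp add: b_def R_def M_def N_def a_def h_def m_def x_def y_def add_ac)
    moreover have "wz_log (Suc n) k = l + d"
      unfolding wz_log_Suc_left by (simp add: l_def d_def M_def N_def a_def h_def m_def x_def y_def add_ac)
    ultimately show ?thesis unfolding wz_F_def by (simp only:)
  qed
  have GS: "wz_G n (Suc k) = b * (a^2 / M) * (P' / N * (l + e) + T')"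
    unfolding wz_G_def wz_base_Suc_right wz_log_Suc_right wz_mult_def wz_mult'_def
    by (simp add: b_def l_def e_def T'_def M_def N_def a_def h_def m_def x_def y_def P'_def Q'_def add_ac)
  have G: "wz_G n k = b * (P / M * l + T)"
    unfolding wz_G_def wz_mult_def wz_mult'_def
    by (simp add: b_def l_def T_def M_def a_def h_def m_def x_def y_def P_def Q_def add_ac)
  have ring: "b * ((A * p' - p) * l + (A * (p' * e + T') - T))
      = b * A * (p' * (l + e) + T') - b * (p * l + T)" for A p p' :: real
    by (simp add: algebra_simps)
  have "wz_F (Suc n) k - wz_F n k = b * ((R - 2 * x) * l + R * d)"
    unfolding FS by (simp add: wz_F_def b_def l_def x_def algebra_simps)
  also have "\<dots> = wz_G n (Suc k) - wz_G n k"
    unfolding z0 z1 GS G by (rule ring)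
  finally show ?thesis .
qed

section \<open>Decay of B and growth of the certificate\<close>

lemma wz_base_0_le: "wz_base 0 k \<le> 1"
proof (induction k)
  case (Suc k)
  have "(real k + 1/2)^2 / (real k + 1)^2 \<le> 1"
    by (simp add: power_mono)
  then have "wz_base 0 k * ((real k + 1/2)^2 / (real k + 1)^2) \<le> 1"
    using Suc wz_base_nonneg[of 0 k] by (intro mult_le_one) auto
  then show ?case
    using wz_base_Suc_right[of 0 k] by simp
qed (simp add: wz_base_def)

text \<open>In the recurrence, \<open>a \<le> m\<close> and \<open>h \<le> (m + 1) / 2\<close> bound
  the quotient by h/8, and the factor 2n+2 on the left absorbs \<open>h\<close>.\<close>

lemma wz_base_Suc_left_le: "wz_base (Suc n) k \<le> wz_base n k / 16"
proof -
  define a h m where "a = real n + real k + 1/2" and "h = real n + 1/2"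
    and "m = 2 * real n + real k + 1"
  have pos: "a > 0" "h > 0" "m > 0" by (auto simp: a_def h_def m_def)
  have "a^2 * h^2 \<le> m^2 * ((m + 1) / 2)^2"
    using pos by (intro mult_mono power_mono) (auto simp: a_def h_def m_def)
  then have "a^2 * h^2 / (m^2 * (m + 1)^2) \<le> 1/4"
    using pos by (simp add: divide_simps power_divide)
  moreover have "a^2 * h^3 / (2 * m^2 * (m + 1)^2) = h / 2 * (a^2 * h^2 / (m^2 * (m + 1)^2))"
    by (simp add: eval_nat_numeral mult_ac)
  ultimately have "a^2 * h^3 / (2 * m^2 * (m + 1)^2) \<le> h / 2 * (1/4)"
    using pos by (metis mult_left_mono less_imp_le half_gt_zero)
  also have "\<dots> \<le> (2 * real (Suc n)) / 16"
    by (simp add: h_def)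
  finally have "2 * real (Suc n) * wz_base (Suc n) k \<le> wz_base n k * ((2 * real (Suc n)) / 16)"
    unfolding wz_base_Suc_left
    by (intro mult_left_mono wz_base_nonneg) (simp add: a_def h_def m_def add_ac)
  then have "2 * real (Suc n) * wz_base (Suc n) k \<le> 2 * real (Suc n) * (wz_base n k / 16)"
    by (simp only: times_divide_eq_right mult.commute)
  then show ?thesis
    by (rule mult_left_le_imp_le) simp
qed

text \<open>The multiplier G / B can grow linearly in \<open>k\<close>, so quadratic decay is needed
  for the terms n > 0 to vanish in the limit. It comes from the step from n = 0 to n = 1; each later
  step gains 1/16.\<close>

lemma wz_base_Suc_le: "wz_base (Suc n) k \<le> (1/16)^n / (real k + 1)^2"
proof (induction n)
  case 0
  have "(real k + 1/2)^2 \<le> (real k + 2)^2" "(real k + 2)^2 > 0"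
    by (auto intro!: power_mono)
  moreover have "v * (1/2)^3 / (2 * w) \<le> 2" if "v \<le> w" "w > 0" for v w :: real
    using that by (subst pos_divide_le_eq) (auto simp: power3_eq_cube)
  ultimately have "(real k + 1/2)^2 * (1/2)^3 / (2 * (real k + 2)^2) \<le> 2"
    by blast
  then have "(real k + 1/2)^2 * (1/2)^3 / (2 * (real k + 2)^2) / (real k + 1)^2
      \<le> 2 / (real k + 1)^2"
    by (rule divide_right_mono) simp
  then have "(real k + 1/2)^2 * (1/2)^3 / (2 * (real k + 1)^2 * (real k + 2)^2)
      \<le> 2 / (real k + 1)^2"
    by (simp add: mult_ac)
  then have "wz_base 0 k * ((real k + 1/2)^2 * (1/2)^3 / (2 * (real k + 1)^2 * (real k + 2)^2))
      \<le> 1 * (2 / (real k + 1)^2)"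
    using wz_base_0_le[of k] wz_base_nonneg[of 0 k] by (intro mult_mono) auto
  then show ?case
    using wz_base_Suc_left[of 0 k] by simp
next
  case (Suc n)
  have "wz_base (Suc (Suc n)) k \<le> wz_base (Suc n) k / 16"
    by (rule wz_base_Suc_left_le)
  also have "\<dots> \<le> (1/16)^n / (real k + 1)^2 / 16"
    using Suc by simp
  finally show ?case by simp
qed

text \<open>Here \<open>wz_base 0 k\<close> is the square of (1/2)_k / k!, and times 2k+1 it is the
  reciprocal of a partial Wallis product.\<close>

lemma wz_base_0_tendsto: "(\<lambda>k. wz_base 0 k * (2 * real k + 1)) \<longlonglongrightarrow> 2 / pi"
proof -
  have "wz_base 0 k * (2 * real k + 1) = 1 / (\<Prod>j=1..k. (4 * real j^2) / (4 * real j^2 - 1))" for k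
  proof (induction k)
    case (Suc k)
    have f: "4 * (real k + 1)^2 - 1 = (2 * real k + 1) * (2 * real k + 3)"
      by (simp add: power2_eq_square algebra_simps)
    have r: "(real k + 1/2)^2 / (real k + 1)^2 * (2 * real (Suc k) + 1)
        = (2 * real k + 1) * ((4 * (real k + 1)^2 - 1) / (4 * (real k + 1)^2))"
      unfolding f by (simp add: divide_simps) (simp add: power2_eq_square algebra_simps)
    have "wz_base 0 (Suc k) * (2 * real (Suc k) + 1)
        = wz_base 0 k * ((real k + 1/2)^2 / (real k + 1)^2 * (2 * real (Suc k) + 1))"
      using wz_base_Suc_right[of 0 k] by simp
    then have "wz_base 0 (Suc k) * (2 * real (Suc k) + 1)
        = wz_base 0 k * (2 * real k + 1) * ((4 * (real k + 1)^2 - 1) / (4 * (real k + 1)^2))"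
      unfolding r by (simp only: mult.assoc)
    then show ?case
      unfolding Suc by (simp add: add.commute)
  qed (simp add: wz_base_def)
  then show ?thesis
    using tendsto_divide[OF tendsto_const[of 1] wallis] by simp
qed

text \<open>Each bound reduces to a polynomial with nonnegative coefficients, evaluated at
  nonnegative arguments.\<close>

lemma cert_bounds:
  fixes x y :: real
  assumes "x \<ge> 0" "y \<ge> 0"
  shows "\<bar>cert0 x y\<bar> \<le> 2 * (2 * x + y + 1)^3" "\<bar>cert1 x y\<bar> \<le> 2 * (2 * x + y + 1)^2"
proof -
  have "0 \<le> cert0 x y"
    unfolding cert0_def using assms by (intro add_nonneg_nonneg mult_nonneg_nonneg) auto
  moreover have "2 * (2 * x + y + 1)^3 - cert0 x y = 11/2 * x^3 + 10 * x^2 * y + 11/2 * x * y^2 + y^3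
      + 49/4 * x^2 + 14 * x * y + 15/4 * y^2 + 65/8 * x + 9/2 * y + 27/16"
    unfolding cert0_def by (simp add: field_simps eval_nat_numeral)
  moreover have "\<dots> \<ge> 0"
    using assms by (intro add_nonneg_nonneg mult_nonneg_nonneg) auto
  ultimately show "\<bar>cert0 x y\<bar> \<le> 2 * (2 * x + y + 1)^3"
    by linarith
  have "2 * (2 * x + y + 1)^2 - cert1 x y = 53/4 * x^2 + 15/2 * x * y + 11/8 * y^2
      + 45/4 * x + 15/4 * y + 37/16"
    unfolding cert1_def by (simp add: field_simps eval_nat_numeral)
  moreover have "\<dots> \<ge> 0"
    using assms by (intro add_nonneg_nonneg mult_nonneg_nonneg) auto
  moreover have "2 * (2 * x + y + 1)^2 + cert1 x y = 11/4 * x^2 + 17/2 * x * y + 21/8 * y^2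
      + 19/4 * x + 17/4 * y + 27/16"
    unfolding cert1_def by (simp add: field_simps eval_nat_numeral)
  moreover have "\<dots> \<ge> 0"
    using assms by (intro add_nonneg_nonneg mult_nonneg_nonneg) auto
  ultimately show "\<bar>cert1 x y\<bar> \<le> 2 * (2 * x + y + 1)^2"
    by linarith
qed

lemma wz_mult_bounds:
  shows "\<bar>wz_mult n k\<bar> \<le> 2 * (2 * real n + real k + 1)" "\<bar>wz_mult' n k\<bar> \<le> 4"
proof -
  define m where "m = 2 * real n + real k + 1"
  have m: "m \<ge> 1" by (simp add: m_def)
  have c: "\<bar>cert0 n k\<bar> \<le> 2 * m^3" "\<bar>cert1 n k\<bar> \<le> 2 * m^2"
    using cert_bounds[of n k] by (auto simp: m_def)
  have "\<bar>cert0 n k / m^2\<bar> \<le> 2 * m"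
    using c(1) m by (simp add: field_simps eval_nat_numeral)
  then show "\<bar>wz_mult n k\<bar> \<le> 2 * (2 * real n + real k + 1)"
    by (simp add: wz_mult_def m_def)
  have "\<bar>cert1 n k\<bar> / ((2 * real n + 1) * m^2) \<le> 2 * m^2 / (1 * m^2)"
    using c(2) m by (intro frac_le mult_right_mono) auto
  moreover have "\<bar>cert0 n k\<bar> / m^4 \<le> 2 * m^3 / m^3"
    using c(1) m by (intro frac_le power_increasing) auto
  ultimately have "\<bar>cert1 n k / ((2 * real n + 1) * m^2)\<bar> + \<bar>cert0 n k / m^4\<bar> \<le> 4"
    using m by (simp add: abs_mult)
  then show "\<bar>wz_mult' n k\<bar> \<le> 4"
    unfolding wz_mult'_def m_def[symmetric] by linarith
qed

lemma wz_G_Suc_bound: "\<bar>wz_G (Suc n) k\<bar> \<le> 58 * (2 * real n + 3) * (1/16)^n / (real k + 1)"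
proof -
  define m where "m = 2 * real (Suc n) + real k + 1"
  \<comment> \<open>The second bound separates \<open>n\<close> from \<open>k\<close>, at the cost
    of one of the two factors k+1 in the denominator.\<close>
  have m: "m \<ge> 1" "m \<le> (2 * real n + 3) * (real k + 1)"
    by (auto simp: m_def algebra_simps)
  have "\<bar>wz_mult (Suc n) k * wz_log (Suc n) k\<bar> \<le> 2 * m * 27"
    unfolding abs_mult using wz_mult_bounds[of "Suc n" k] wz_log_bound[of "Suc n" k] m
    by (intro mult_mono) (auto simp: m_def)
  \<comment> \<open>58 = 2 * 27 + 4, as 4 is at most 4m.\<close>
  then have "\<bar>wz_mult (Suc n) k * wz_log (Suc n) k + wz_mult' (Suc n) k\<bar> \<le> 58 * m"
    using wz_mult_bounds(2)[of "Suc n" k] m by linarith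
  also have "\<dots> \<le> 58 * ((2 * real n + 3) * (real k + 1))"
    using m by simp
  finally have "\<bar>wz_G (Suc n) k\<bar>
      \<le> (1/16)^n / (real k + 1)^2 * (58 * ((2 * real n + 3) * (real k + 1)))"
    unfolding wz_G_def abs_mult using wz_base_Suc_le[of n k] wz_base_nonneg[of "Suc n" k]
    by (intro mult_mono) auto
  also have "\<dots> = 58 * (2 * real n + 3) * (1/16)^n / (real k + 1)"
    by (simp add: divide_simps) (simp add: power2_eq_square)
  finally show ?thesis .
qed

section \<open>Summation over n and independence of k\<close>

lemma wz_F_tendsto: "(\<lambda>n. wz_F n k) \<longlonglongrightarrow> 0"
proof -
  have "\<bar>wz_F (Suc n) k\<bar> \<le> 54 * (real n + 1) * (1/16)^n" for n
  proof -
    have "(1/16)^n / (real k + 1)^2 \<le> (1/16::real)^n / 1"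
      by (intro divide_left_mono) auto
    then have "wz_base (Suc n) k \<le> (1/16)^n"
      using wz_base_Suc_le[of n k] by simp
    then have "\<bar>wz_F (Suc n) k\<bar> \<le> 2 * real (Suc n) * (1/16)^n * 27"
      unfolding wz_F_def abs_mult
      using wz_log_bound[of "Suc n" k] wz_base_nonneg[of "Suc n" k]
      by (intro mult_mono) auto
    then show ?thesis by (simp add: algebra_simps)
  qed
  moreover have "(\<lambda>n. 54 * (real n + 1) * (1/16)^n) \<longlonglongrightarrow> 0"
    by real_asymp
  ultimately have "(\<lambda>n. wz_F (Suc n) k) \<longlonglongrightarrow> 0"
    by (metis (no_types, lifting) Lim_null_comparison always_eventually real_norm_def)
  then show ?thesis by (rule LIMSEQ_imp_Suc)
qed

lemma summable_majorant: "summable (\<lambda>n. 58 * (2 * real n + 3) * (1/16)^n)"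
proof (rule summable_comparison_test_ev)
  \<comment> \<open>Splitting 1/16 as 1/8 * 1/2 lets the first factor absorb the linear term and
    leaves a geometric series.\<close>
  have "(\<lambda>n. 58 * (2 * real n + 3) * (1/8)^n) \<longlonglongrightarrow> 0"
    by real_asymp
  then have "eventually (\<lambda>n. 58 * (2 * real n + 3) * (1/8)^n < 1) sequentially"
    by (rule order_tendstoD) simp
  then show "eventually (\<lambda>n. norm (58 * (2 * real n + 3) * (1/16)^n) \<le> (1/2)^n) sequentially"
  proof eventually_elim
    case (elim n)
    have "norm (58 * (2 * real n + 3) * (1/16)^n) = 58 * (2 * real n + 3) * (1/8)^n * (1/2)^n"
      by (simp add: abs_mult flip: power_mult_distrib)
    also have "\<dots> \<le> 1 * (1/2)^n"
      using elim by (intro mult_right_mono) auto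
    finally show ?case by simp
  qed
  show "summable (\<lambda>n. (1/2::real)^n)" by (simp add: summable_geometric)
qed

lemma summable_wz_G_Suc: "summable (\<lambda>n. wz_G (Suc n) k)"
proof (rule summable_comparison_test')
  show "summable (\<lambda>n. 58 * (2 * real n + 3) * (1/16)^n / (real k + 1))"
    using summable_majorant by (rule summable_divide)
  show "norm (wz_G (Suc n) k) \<le> 58 * (2 * real n + 3) * (1/16)^n / (real k + 1)" for n
    using wz_G_Suc_bound by simp
qed

lemma summable_wz_G: "summable (\<lambda>n. wz_G n k)"
  using summable_wz_G_Suc summable_Suc_iff[of "\<lambda>n. wz_G n k"] by blast

lemma suminf_wz_G_Suc_right: "(\<Sum>n. wz_G n (Suc k)) = (\<Sum>n. wz_G n k)"
proof -
  have "(\<Sum>n<N. wz_G n (Suc k) - wz_G n k) = wz_F N k" for N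
  proof -
    have "(\<Sum>n<N. wz_G n (Suc k) - wz_G n k) = (\<Sum>n<N. wz_F (Suc n) k - wz_F n k)"
      by (simp only: wz_pair)
    also have "\<dots> = wz_F N k"
      by (subst sum_lessThan_telescope) (simp add: wz_F_def)
    finally show ?thesis .
  qed
  then have "(\<lambda>n. wz_G n (Suc k) - wz_G n k) sums 0"
    using wz_F_tendsto by (simp add: sums_def)
  then show ?thesis
    using suminf_diff[OF summable_wz_G summable_wz_G, of "Suc k" k] by (simp add: sums_iff)
qed

lemma suminf_wz_G_eq_0: "(\<Sum>n. wz_G n k) = (\<Sum>n. wz_G n 0)"
  by (induction k) (simp_all add: suminf_wz_G_Suc_right)

section \<open>The limit as k tends to infinity\<close>

lemma wz_G_0_tendsto: "wz_G 0 \<longlonglongrightarrow> - pi / 48"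
proof -
  \<comment> \<open>The value is pi^2/6 - 3/8 * pi^2/2.\<close>
  have L: "wz_log 0 \<longlonglongrightarrow> - (pi^2) / 48"
    using tendsto_diff[OF harm2_tendsto tendsto_mult[OF tendsto_const[of "3/8"] odd_harm2_tendsto]]
    by (simp add: wz_log_def[abs_def] odd_harm2_def[of 0] harm2_def[of 0])
  have M: "(\<lambda>k. wz_mult 0 k / (2 * real k + 1)) \<longlonglongrightarrow> 1/2"
    unfolding wz_mult_def cert0_def by simp real_asymp
  have M': "(\<lambda>k. wz_mult' 0 k / (2 * real k + 1)) \<longlonglongrightarrow> 0"
    unfolding wz_mult'_def cert0_def cert1_def by simp real_asymp
  \<comment> \<open>Moving 2k+1 from the multiplier to the base gives every factor a finite
    limit.\<close>
  have "wz_G 0 k = wz_base 0 k * (2 * real k + 1)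
      * (wz_mult 0 k / (2 * real k + 1) * wz_log 0 k + wz_mult' 0 k / (2 * real k + 1))" for k
  proof -
    have "2 * real k + 1 \<noteq> 0" by linarith
    then show ?thesis by (simp add: wz_G_def divide_simps)
  qed
  then have G: "wz_G 0 = (\<lambda>k. wz_base 0 k * (2 * real k + 1)
      * (wz_mult 0 k / (2 * real k + 1) * wz_log 0 k + wz_mult' 0 k / (2 * real k + 1)))"
    by blast
  have "(\<lambda>k. wz_base 0 k * (2 * real k + 1)
      * (wz_mult 0 k / (2 * real k + 1) * wz_log 0 k + wz_mult' 0 k / (2 * real k + 1)))
      \<longlonglongrightarrow> 2 / pi * (1/2 * (- (pi^2) / 48) + 0)"
    by (intro tendsto_mult tendsto_add wz_base_0_tendsto M M' L)
  then show ?thesis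
    unfolding G by (simp add: power2_eq_square)
qed

lemma wz_G_sums: "(\<lambda>n. wz_G n 0) sums (- pi / 48)"
proof -
  define C where "C = (\<Sum>n. 58 * (2 * real n + 3) * (1/16)^n)"
  have "(\<Sum>n. wz_G n 0) = wz_G 0 k + (\<Sum>n. wz_G (Suc n) k)" for k
    using suminf_split_head[OF summable_wz_G, of k] suminf_wz_G_eq_0[of k] by simp
  moreover have "(\<lambda>k. \<Sum>n. wz_G (Suc n) k) \<longlonglongrightarrow> 0"
  proof (rule Lim_null_comparison)
    have "norm (\<Sum>n. wz_G (Suc n) k) \<le> C / (real k + 1)" for k
      unfolding C_def suminf_divide[OF summable_majorant, symmetric]
      using wz_G_Suc_bound
      by (intro norm_suminf_le summable_divide summable_majorant) auto
    then show "\<forall>\<^sub>F k in sequentially. norm (\<Sum>n. wz_G (Suc n) k) \<le> C / (real k + 1)"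
      by simp
    show "(\<lambda>k. C / (real k + 1)) \<longlonglongrightarrow> 0" by real_asymp
  qed
  then have "(\<lambda>k. wz_G 0 k + (\<Sum>n. wz_G (Suc n) k)) \<longlonglongrightarrow> - pi / 48 + 0"
    by (intro tendsto_add wz_G_0_tendsto)
  ultimately have "(\<lambda>k. \<Sum>n. wz_G n 0) \<longlonglongrightarrow> - pi / 48"
    by simp
  then have "(\<Sum>n. wz_G n 0) = - pi / 48"
    by (simp add: LIMSEQ_const_iff)
  then show ?thesis
    using summable_wz_G sums_iff by blast
qed

section \<open>Identification of the terms at k = 0\<close>

lemma wz_G_right_0:
  "wz_G n 0 = - 23/32 * ((42 * real n + 5) * ((pochhammer (1/2) n)^3 / ((fact n)^3 * 64^n))
     * (harm2 (2 * n) - 25/92 * harm2 n))"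
proof -
  define p f where "p = pochhammer (1/2::real) n" and "f = (fact n :: real)"
  have p: "p > 0" unfolding p_def by (intro pochhammer_pos) auto
  have f: "f > 0" by (simp add: f_def)
  have "(fact (2 * n) :: real) = 4^n * p * f"
    by (simp add: fact_double p_def f_def power_mult)
  then have "wz_base n 0 = p^6 / ((4^n * p * f)^3)"
    by (simp add: wz_base_def p_def[symmetric] eval_nat_numeral mult_ac)
  also have "\<dots> = p^3 / (f^3 * (4^n)^3)"
    using p by (simp add: power_mult_distrib eval_nat_numeral)
  also have "(4^n)^3 = (64::real)^n"
    by (simp flip: power_mult add: mult.commute[of n]) (simp add: power_mult)
  finally have B: "wz_base n 0 = p^3 / (f^3 * 64^n)" .
  define m X where "m = 2 * real n + 1" and "X = (42 * real n + 5) / 16"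
  have m: "m > 0" by (simp add: m_def)
  \<comment> \<open>At k = 0 the two parts of \<open>wz_mult'\<close> are -X/m^2 and X/m^2, so no
    term free of harmonic numbers survives.\<close>
  have "cert0 n 0 = m^2 * X" "cert1 n 0 = - (m * X)"
    by (simp_all add: cert0_def cert1_def m_def X_def)
  with m have S: "wz_mult n 0 = X" "wz_mult' n 0 = 0"
    unfolding wz_mult_def wz_mult'_def by (simp_all flip: m_def add: eval_nat_numeral)
  define D where "D = harm2 (2 * n) - 25/92 * harm2 n"
  \<comment> \<open>Since 3/8 + 11/4 = 25/8, the coefficients are 1 - 25/2 = -23/2 and 25/8, with
    ratio -25/92.\<close>
  have L: "wz_log n 0 = - 23/2 * D"
    by (simp add: wz_log_def odd_harm2_def D_def field_simps)
  show ?thesis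
    unfolding wz_G_def B S L D_def[symmetric] p_def[symmetric] f_def[symmetric] X_def by (simp add: mult_ac)
qed

theorem theorem1p2:
  shows "(\<lambda>k::nat. (42 * real k + 5) * ((pochhammer (1/2 :: real) k)^3 / ((fact k)^3 * 64^k))
            * (harm2 (2 * k) - 25/92 * harm2 k))
         sums (2 * pi / 69)"
proof -
  have c: "- 32/23 * (- 23/32 * x) = x" for x :: real by simp
  have "(\<lambda>n. - 32/23 * wz_G n 0) sums (- 32/23 * (- pi / 48))"
    by (intro sums_mult wz_G_sums)
  then show ?thesis
    unfolding wz_G_right_0 c by simp
qed

end
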